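(* Let $\rho,\sigma$ be gauges and let $(x_n)_n:{}^{\sigma}\widetilde{\mathbb N}\to{}^{\rho}\widetilde{\mathbb R}$ be a hypersequence. Assume that $C$ is a sharply closed subset of ${}^{\rho}\widetilde{\mathbb R}$, that the hyperlimit of $(x_n)_n$ exists and equals $l$, and that $x_n$ eventually lies in $C$, i.e. $\exists N\in{}^{\sigma}\widetilde{\mathbb N}\,\forall n\in{}^{\sigma}\widetilde{\mathbb N}_{\ge N}:\ x_n\in C$. Then $l\in C$. In particular, if $(y_n)_n:{}^{\sigma}\widetilde{\mathbb N}\to{}^{\rho}\widetilde{\mathbb R}$ is another hypersequence whose hyperlimit exists and equals $k$, then $\exists N\in{}^{\sigma}\widetilde{\mathbb N}\,\forall n\in{}^{\sigma}\widetilde{\mathbb N}_{\ge N}:\ x_n\ge y_n$ implies $l\ge k$.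
   Context: Let $I=(0,1]$. A gauge is a net $\rho=(\rho_\varepsilon)_{\varepsilon\in I}\in(0,1]^I$ with $\rho_\varepsilon\to0$ as $\varepsilon\to0^+$. "$\forall^0\varepsilon:\ P(\varepsilon)$" means: there is $\varepsilon_0\in I$ such that $P(\varepsilon)$ holds for all $\varepsilon\in(0,\varepsilon_0]$. $\mathbb R_\rho$ is the ring of $\rho$-moderate nets: $(x_\varepsilon)\in\mathbb R^I$ with $\exists N\in\mathbb N\,\forall^0\varepsilon:\ |x_\varepsilon|\le\rho_\varepsilon^{-N}$. Write $(x_\varepsilon)\sim_\rho(y_\varepsilon)$ if $\forall n\in\mathbb N\,\forall^0\varepsilon:\ |x_\varepsilon-y_\varepsilon|\le\rho_\varepsilon^n$; a net is $\rho$-negligible if it is $\sim_\rho 0$. ${}^{\rho}\widetilde{\mathbb R}:=\mathbb R_\rho/\sim_\rho$ (a ring with pointwise operations); classes are denoted $[x_\varepsilon]$. Order: $[x_\varepsilon]\le[y_\varepsilon]$ iff there is a $\rho$-negligible $(z_\varepsilon)$ with $\forall^0\varepsilon:\ x_\varepsilon\le y_\varepsilon+z_\varepsilon$; $x<y$ means $x\le y$ and $y-x$ is invertible. $|[x_\varepsilon]|:=[|x_\varepsilon|]$, and $\mathrm d\rho:=[\rho_\varepsilon]$. The sharp topology on ${}^{\rho}\widetilde{\mathbb R}$ has as base the balls $B_r(x)=\{y\mid |y-x|<r\}$, $r>0$; "sharply closed" means closed in this topology. Given a gauge $\sigma$, ${}^{\sigma}\widetilde{\mathbb N}:=\{[n_\varepsilon]\in{}^{\sigma}\widetilde{\mathbb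 R}\mid n_\varepsilon\in\mathbb N\ \forall\varepsilon\}$, ordered by the order $\le$ of ${}^{\sigma}\widetilde{\mathbb R}$, and ${}^{\sigma}\widetilde{\mathbb N}_{\ge N}:=\{n\in{}^{\sigma}\widetilde{\mathbb N}\mid n\ge N\}$. A hypersequence is a map $x:{}^{\sigma}\widetilde{\mathbb N}\to{}^{\rho}\widetilde{\mathbb R}$, $x_n:=x(n)$. An element $l\in{}^{\rho}\widetilde{\mathbb R}$ is the (necessarily unique) hyperlimit of $(x_n)_n$ if $\forall q\in\mathbb N\,\exists M\in{}^{\sigma}\widetilde{\mathbb N}\,\forall n\in{}^{\sigma}\widetilde{\mathbb N}_{\ge M}:\ |x_n-l|<\mathrm d\rho^q$. *)

theory Defs
  imports "HOL-Analysis.Analysis" "HOL-Algebra.Ring"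
begin

text \<open>
  A net is a function \<open>real \<Rightarrow> real\<close> of which only the values on the index set \<open>{0<..1}\<close>
  are meaningful. Every condition on nets below is either restricted to \<open>{0<..1}\<close> or of the form
  ``for all sufficiently small \<open>\<epsilon> > 0\<close>'', expressed by the filter \<open>at_right 0\<close>, so the
  values outside of the index set play no role.
\<close>

lemma eventually_at_right_0_iff_index:
  fixes P :: "real \<Rightarrow> bool"
  shows "(\<forall>\<^sub>F \<epsilon> in at_right 0. P \<epsilon>) \<longleftrightarrow> (\<exists>\<epsilon>0\<in>{0<..1}. \<forall>\<epsilon>\<in>{0<..\<epsilon>0}. P \<epsilon>)"
proof
  assume "\<forall>\<^sub>F \<epsilon> in at_right 0. P \<epsilon>"
  then obtain b where b: "b > 0" "\<And>\<epsilon>. \<epsilon> > 0 \<Longrightarrow> \<epsilon> < b \<Longrightarrow> P \<epsilon>"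
    unfolding eventually_at_right_field by auto
  then have "min 1 (b / 2) \<in> {0<..1}" "\<forall>\<epsilon>\<in>{0<..min 1 (b / 2)}. P \<epsilon>"
    by auto
  then show "\<exists>\<epsilon>0\<in>{0<..1}. \<forall>\<epsilon>\<in>{0<..\<epsilon>0}. P \<epsilon>"
    by blast
next
  assume "\<exists>\<epsilon>0\<in>{0<..1}. \<forall>\<epsilon>\<in>{0<..\<epsilon>0}. P \<epsilon>"
  then obtain e where "e \<in> {0<..1}" "\<forall>\<epsilon>\<in>{0<..e}. P \<epsilon>"
    by blast
  then show "\<forall>\<^sub>F \<epsilon> in at_right 0. P \<epsilon>"
    unfolding eventually_at_right_field by (intro exI[of _ e]) auto
qed

definition gauge_net :: "(real \<Rightarrow> real) \<Rightarrow> bool" where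
  "gauge_net \<rho> \<longleftrightarrow> (\<forall>\<epsilon>\<in>{0<..1}. \<rho> \<epsilon> \<in> {0<..1}) \<and> (\<rho> \<longlongrightarrow> 0) (at_right 0)"

definition moderate_nets :: "(real \<Rightarrow> real) \<Rightarrow> (real \<Rightarrow> real) set" where
  "moderate_nets \<rho> = {x. \<exists>N::nat. \<forall>\<^sub>F \<epsilon> in at_right 0. \<bar>x \<epsilon>\<bar> \<le> \<rho> \<epsilon> powi (- int N)}"

definition net_sim :: "(real \<Rightarrow> real) \<Rightarrow> (real \<Rightarrow> real) \<Rightarrow> (real \<Rightarrow> real) \<Rightarrow> bool" where
  "net_sim \<rho> x y \<longleftrightarrow> (\<forall>n::nat. \<forall>\<^sub>F \<epsilon> in at_right 0. \<bar>x \<epsilon> - y \<epsilon>\<bar> \<le> \<rho> \<epsilon> ^ n)"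

definition negligible_net :: "(real \<Rightarrow> real) \<Rightarrow> (real \<Rightarrow> real) \<Rightarrow> bool" where
  "negligible_net \<rho> z \<longleftrightarrow> net_sim \<rho> z (\<lambda>_. 0)"

definition rc_rel :: "(real \<Rightarrow> real) \<Rightarrow> ((real \<Rightarrow> real) \<times> (real \<Rightarrow> real)) set" where
  "rc_rel \<rho> = {(x, y). x \<in> moderate_nets \<rho> \<and> y \<in> moderate_nets \<rho> \<and> net_sim \<rho> x y}"

definition rc_class :: "(real \<Rightarrow> real) \<Rightarrow> (real \<Rightarrow> real) \<Rightarrow> (real \<Rightarrow> real) set" where
  "rc_class \<rho> x = rc_rel \<rho> `` {x}"

text \<open>
  The prefix \<open>rc\<close> stands for Robinson-Colombeau. The unions over all representatives in the ring
  operations each consist of a single class, see \<open>rc_add\<close> and \<open>rc_mult\<close> below.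
\<close>

definition rc_ring :: "(real \<Rightarrow> real) \<Rightarrow> (real \<Rightarrow> real) set ring" where
  "rc_ring \<rho> =
    \<lparr>carrier = moderate_nets \<rho> // rc_rel \<rho>,
     mult = (\<lambda>X Y. \<Union>x\<in>X. \<Union>y\<in>Y. rc_class \<rho> (\<lambda>\<epsilon>. x \<epsilon> * y \<epsilon>)),
     one = rc_class \<rho> (\<lambda>_. 1),
     zero = rc_class \<rho> (\<lambda>_. 0),
     add = (\<lambda>X Y. \<Union>x\<in>X. \<Union>y\<in>Y. rc_class \<rho> (\<lambda>\<epsilon>. x \<epsilon> + y \<epsilon>))\<rparr>"

lemma gauge_net_eventually:
  assumes "gauge_net \<rho>"
  shows "\<forall>\<^sub>F \<epsilon> in at_right 0. 0 < \<rho> \<epsilon> \<and> \<rho> \<epsilon> < 1 / 2"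
proof -
  have "\<forall>\<^sub>F \<epsilon> in at_right 0. 0 < \<rho> \<epsilon>"
    unfolding eventually_at_right_0_iff_index
    using assms by (intro bexI[of _ 1]) (auto simp: gauge_net_def)
  moreover have "\<forall>\<^sub>F \<epsilon> in at_right 0. \<rho> \<epsilon> < 1 / 2"
    using assms by (intro order_tendstoD(2)[of \<rho> 0]) (auto simp: gauge_net_def)
  ultimately show ?thesis
    by eventually_elim auto
qed

lemma moderate_netsI:
  assumes "gauge_net \<rho>" and "\<forall>\<^sub>F \<epsilon> in at_right 0. \<bar>x \<epsilon>\<bar> * \<rho> \<epsilon> ^ N \<le> 1"
  shows "x \<in> moderate_nets \<rho>"
  unfolding moderate_nets_def mem_Collect_eq
proof (intro exI[of _ N])
  show "\<forall>\<^sub>F \<epsilon> in at_right 0. \<bar>x \<epsilon>\<bar> \<le> \<rho> \<epsilon> powi (- int N)"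
    using assms(2) gauge_net_eventually[OF assms(1)]
    by eventually_elim (simp add: power_int_minus field_simps)
qed

lemma moderate_netsE:
  assumes "gauge_net \<rho>" and "x \<in> moderate_nets \<rho>"
  obtains N where "\<forall>\<^sub>F \<epsilon> in at_right 0. \<bar>x \<epsilon>\<bar> * \<rho> \<epsilon> ^ N \<le> 1"
proof -
  obtain N :: nat where "\<forall>\<^sub>F \<epsilon> in at_right 0. \<bar>x \<epsilon>\<bar> \<le> \<rho> \<epsilon> powi (- int N)"
    using assms(2) by (auto simp: moderate_nets_def)
  then have "\<forall>\<^sub>F \<epsilon> in at_right 0. \<bar>x \<epsilon>\<bar> * \<rho> \<epsilon> ^ N \<le> 1"
    using gauge_net_eventually[OF assms(1)]
    by eventually_elim (simp add: power_int_minus field_simps)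
  then show ?thesis
    by (rule that)
qed

lemma moderate_bounded:
  assumes "gauge_net \<rho>" and "\<forall>\<^sub>F \<epsilon> in at_right 0. \<bar>x \<epsilon>\<bar> \<le> 1"
  shows "x \<in> moderate_nets \<rho>"
  by (rule moderate_netsI[OF assms(1), of _ 0]) (use assms(2) in simp)

lemma moderate_const:
  assumes "gauge_net \<rho>"
  shows "(\<lambda>_. 0) \<in> moderate_nets \<rho>" and "(\<lambda>_. 1) \<in> moderate_nets \<rho>"
  by (auto intro!: moderate_bounded assms)

lemma moderate_minus:
  assumes "x \<in> moderate_nets \<rho>"
  shows "(\<lambda>\<epsilon>. - x \<epsilon>) \<in> moderate_nets \<rho>"
  using assms by (simp add: moderate_nets_def)

lemma moderate_abs:
  assumes "x \<in> moderate_nets \<rho>"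
  shows "(\<lambda>\<epsilon>. \<bar>x \<epsilon>\<bar>) \<in> moderate_nets \<rho>"
  using assms by (simp add: moderate_nets_def)

lemma moderate_mult:
  assumes "gauge_net \<rho>" "x \<in> moderate_nets \<rho>" "y \<in> moderate_nets \<rho>"
  shows "(\<lambda>\<epsilon>. x \<epsilon> * y \<epsilon>) \<in> moderate_nets \<rho>"
proof -
  obtain N where "\<forall>\<^sub>F \<epsilon> in at_right 0. \<bar>x \<epsilon>\<bar> * \<rho> \<epsilon> ^ N \<le> 1"
    using moderate_netsE[OF assms(1,2)] .
  moreover obtain M where "\<forall>\<^sub>F \<epsilon> in at_right 0. \<bar>y \<epsilon>\<bar> * \<rho> \<epsilon> ^ M \<le> 1"
    using moderate_netsE[OF assms(1,3)] .
  ultimately have "\<forall>\<^sub>F \<epsilon> in at_right 0. \<bar>x \<epsilon> * y \<epsilon>\<bar> * \<rho> \<epsilon> ^ (N + M) \<le> 1"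
    using gauge_net_eventually[OF assms(1)]
  proof eventually_elim
    case (elim \<epsilon>)
    have "(\<bar>x \<epsilon>\<bar> * \<rho> \<epsilon> ^ N) * (\<bar>y \<epsilon>\<bar> * \<rho> \<epsilon> ^ M) \<le> 1 * 1"
      using elim by (intro mult_mono) auto
    then show ?case
      by (simp add: abs_mult power_add mult_ac)
  qed
  then show ?thesis
    by (rule moderate_netsI[OF assms(1)])
qed

lemma moderate_add:
  assumes "gauge_net \<rho>" "x \<in> moderate_nets \<rho>" "y \<in> moderate_nets \<rho>"
  shows "(\<lambda>\<epsilon>. x \<epsilon> + y \<epsilon>) \<in> moderate_nets \<rho>"
proof -
  obtain N where "\<forall>\<^sub>F \<epsilon> in at_right 0. \<bar>x \<epsilon>\<bar> * \<rho> \<epsilon> ^ N \<le> 1"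
    using moderate_netsE[OF assms(1,2)] .
  moreover obtain M where "\<forall>\<^sub>F \<epsilon> in at_right 0. \<bar>y \<epsilon>\<bar> * \<rho> \<epsilon> ^ M \<le> 1"
    using moderate_netsE[OF assms(1,3)] .
  ultimately have "\<forall>\<^sub>F \<epsilon> in at_right 0. \<bar>x \<epsilon> + y \<epsilon>\<bar> * \<rho> \<epsilon> ^ (N + M + 1) \<le> 1"
    using gauge_net_eventually[OF assms(1)]
  proof eventually_elim
    case (elim \<epsilon>)
    have "\<bar>x \<epsilon>\<bar> * \<rho> \<epsilon> ^ N * \<rho> \<epsilon> ^ M \<le> 1 * 1"
      using elim by (intro mult_mono power_le_one) auto
    moreover have "\<bar>y \<epsilon>\<bar> * \<rho> \<epsilon> ^ M * \<rho> \<epsilon> ^ N \<le> 1 * 1"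
      using elim by (intro mult_mono power_le_one) auto
    moreover have "\<bar>x \<epsilon> + y \<epsilon>\<bar> * \<rho> \<epsilon> ^ (N + M) \<le> (\<bar>x \<epsilon>\<bar> + \<bar>y \<epsilon>\<bar>) * \<rho> \<epsilon> ^ (N + M)"
      using elim by (intro mult_right_mono) auto
    ultimately have "\<bar>x \<epsilon> + y \<epsilon>\<bar> * \<rho> \<epsilon> ^ (N + M) \<le> 2"
      by (simp add: power_add algebra_simps)
    then have "(\<bar>x \<epsilon> + y \<epsilon>\<bar> * \<rho> \<epsilon> ^ (N + M)) * \<rho> \<epsilon> \<le> 2 * (1 / 2)"
      using elim by (intro mult_mono) auto
    then show ?case
      by (simp add: mult_ac)
  qed
  then show ?thesis
    by (rule moderate_netsI[OF assms(1)])
qed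

lemma moderate_diff:
  assumes "gauge_net \<rho>" "x \<in> moderate_nets \<rho>" "y \<in> moderate_nets \<rho>"
  shows "(\<lambda>\<epsilon>. x \<epsilon> - y \<epsilon>) \<in> moderate_nets \<rho>"
  using moderate_add[OF assms(1,2) moderate_minus[OF assms(3)]] by simp

lemma net_sim_sum:
  assumes g: "gauge_net \<rho>" and "net_sim \<rho> x x'" and "net_sim \<rho> y y'"
    and le: "\<forall>\<^sub>F \<epsilon> in at_right 0. \<bar>u \<epsilon> - v \<epsilon>\<bar> \<le> \<bar>x \<epsilon> - x' \<epsilon>\<bar> + \<bar>y \<epsilon> - y' \<epsilon>\<bar>"
  shows "net_sim \<rho> u v"
  unfolding net_sim_def
proof
  fix n
  have "\<forall>\<^sub>F \<epsilon> in at_right 0. \<bar>x \<epsilon> - x' \<epsilon>\<bar> \<le> \<rho> \<epsilon> ^ Suc n"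
       "\<forall>\<^sub>F \<epsilon> in at_right 0. \<bar>y \<epsilon> - y' \<epsilon>\<bar> \<le> \<rho> \<epsilon> ^ Suc n"
    using assms(2,3) unfolding net_sim_def by blast+
  then show "\<forall>\<^sub>F \<epsilon> in at_right 0. \<bar>u \<epsilon> - v \<epsilon>\<bar> \<le> \<rho> \<epsilon> ^ n"
    using gauge_net_eventually[OF g] le
  proof eventually_elim
    case (elim \<epsilon>)
    have "\<rho> \<epsilon> * \<rho> \<epsilon> ^ n \<le> 1 / 2 * \<rho> \<epsilon> ^ n"
      using elim by (intro mult_right_mono) auto
    then show ?case
      using elim unfolding power_Suc by linarith
  qed
qed

lemma net_sim_refl:
  assumes "gauge_net \<rho>"
  shows "net_sim \<rho> x x"
  unfolding net_sim_def
proof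
  fix n
  show "\<forall>\<^sub>F \<epsilon> in at_right 0. \<bar>x \<epsilon> - x \<epsilon>\<bar> \<le> \<rho> \<epsilon> ^ n"
    using gauge_net_eventually[OF assms] by eventually_elim auto
qed

lemma net_sim_eventually_eq:
  assumes "gauge_net \<rho>" and "\<forall>\<^sub>F \<epsilon> in at_right 0. x \<epsilon> = y \<epsilon>"
  shows "net_sim \<rho> x y"
  by (rule net_sim_sum[OF assms(1) net_sim_refl[OF assms(1), of "\<lambda>_. 0"]
        net_sim_refl[OF assms(1), of "\<lambda>_. 0"]])
     (use assms(2) in eventually_elim, auto)

lemma net_sim_sym: "net_sim \<rho> x y \<Longrightarrow> net_sim \<rho> y x"
  by (simp add: net_sim_def abs_minus_commute)

lemma net_sim_trans:
  assumes "gauge_net \<rho>" "net_sim \<rho> x y" "net_sim \<rho> y z"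
  shows "net_sim \<rho> x z"
  by (rule net_sim_sum[OF assms]) (intro always_eventually allI, linarith)

lemma net_sim_add:
  assumes "gauge_net \<rho>" "net_sim \<rho> x x'" "net_sim \<rho> y y'"
  shows "net_sim \<rho> (\<lambda>\<epsilon>. x \<epsilon> + y \<epsilon>) (\<lambda>\<epsilon>. x' \<epsilon> + y' \<epsilon>)"
  by (rule net_sim_sum[OF assms]) (intro always_eventually allI, linarith)

lemma net_sim_abs:
  assumes "gauge_net \<rho>" "net_sim \<rho> x x'"
  shows "net_sim \<rho> (\<lambda>\<epsilon>. \<bar>x \<epsilon>\<bar>) (\<lambda>\<epsilon>. \<bar>x' \<epsilon>\<bar>)"
  by (rule net_sim_sum[OF assms(1,2) net_sim_refl[OF assms(1)]])
     (intro always_eventually allI, linarith)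

lemma net_sim_mult_right:
  assumes g: "gauge_net \<rho>" and z: "z \<in> moderate_nets \<rho>" and s: "net_sim \<rho> x y"
  shows "net_sim \<rho> (\<lambda>\<epsilon>. x \<epsilon> * z \<epsilon>) (\<lambda>\<epsilon>. y \<epsilon> * z \<epsilon>)"
  unfolding net_sim_def
proof
  fix n
  obtain N where "\<forall>\<^sub>F \<epsilon> in at_right 0. \<bar>z \<epsilon>\<bar> * \<rho> \<epsilon> ^ N \<le> 1"
    using moderate_netsE[OF g z] .
  moreover have "\<forall>\<^sub>F \<epsilon> in at_right 0. \<bar>x \<epsilon> - y \<epsilon>\<bar> \<le> \<rho> \<epsilon> ^ (n + N)"
    using s by (auto simp: net_sim_def)
  ultimately show "\<forall>\<^sub>F \<epsilon> in at_right 0. \<bar>x \<epsilon> * z \<epsilon> - y \<epsilon> * z \<epsilon>\<bar> \<le> \<rho> \<epsilon> ^ n"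
    using gauge_net_eventually[OF g]
  proof eventually_elim
    case (elim \<epsilon>)
    have "\<bar>x \<epsilon> * z \<epsilon> - y \<epsilon> * z \<epsilon>\<bar> = \<bar>x \<epsilon> - y \<epsilon>\<bar> * \<bar>z \<epsilon>\<bar>"
      by (simp add: left_diff_distrib flip: abs_mult)
    also have "\<dots> \<le> \<rho> \<epsilon> ^ (n + N) * \<bar>z \<epsilon>\<bar>"
      using elim by (intro mult_right_mono) auto
    also have "\<dots> = \<rho> \<epsilon> ^ n * (\<bar>z \<epsilon>\<bar> * \<rho> \<epsilon> ^ N)"
      by (simp add: power_add)
    also have "\<dots> \<le> \<rho> \<epsilon> ^ n * 1"
      using elim by (intro mult_left_mono) auto
    finally show ?case
      by simp
  qed
qed

lemma net_sim_mult:
  assumes "gauge_net \<rho>" "x' \<in> moderate_nets \<rho>" "y \<in> moderate_nets \<rho>"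
    and "net_sim \<rho> x x'" "net_sim \<rho> y y'"
  shows "net_sim \<rho> (\<lambda>\<epsilon>. x \<epsilon> * y \<epsilon>) (\<lambda>\<epsilon>. x' \<epsilon> * y' \<epsilon>)"
proof (rule net_sim_trans[OF assms(1)])
  show "net_sim \<rho> (\<lambda>\<epsilon>. x \<epsilon> * y \<epsilon>) (\<lambda>\<epsilon>. x' \<epsilon> * y \<epsilon>)"
    by (rule net_sim_mult_right[OF assms(1,3,4)])
  show "net_sim \<rho> (\<lambda>\<epsilon>. x' \<epsilon> * y \<epsilon>) (\<lambda>\<epsilon>. x' \<epsilon> * y' \<epsilon>)"
    using net_sim_mult_right[OF assms(1,2,5)] by (simp add: mult.commute)
qed

lemma equiv_rc_rel:
  assumes "gauge_net \<rho>"
  shows "equiv (moderate_nets \<rho>) (rc_rel \<rho>)"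
  unfolding equiv_def refl_on_def sym_on_def trans_on_def rc_rel_def
  using net_sim_refl[OF assms] net_sim_sym net_sim_trans[OF assms] by blast

lemma mem_rc_class_iff:
  "y \<in> rc_class \<rho> x \<longleftrightarrow> x \<in> moderate_nets \<rho> \<and> y \<in> moderate_nets \<rho> \<and> net_sim \<rho> x y"
  by (auto simp: rc_class_def rc_rel_def)

lemma rc_class_self: "gauge_net \<rho> \<Longrightarrow> x \<in> moderate_nets \<rho> \<Longrightarrow> x \<in> rc_class \<rho> x"
  by (simp add: mem_rc_class_iff net_sim_refl)

lemma rc_class_eq_iff:
  assumes "gauge_net \<rho>" "x \<in> moderate_nets \<rho>" "y \<in> moderate_nets \<rho>"
  shows "rc_class \<rho> x = rc_class \<rho> y \<longleftrightarrow> net_sim \<rho> x y"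
  using eq_equiv_class_iff[OF equiv_rc_rel[OF assms(1)] assms(2,3)] assms(2,3)
  by (simp add: rc_class_def rc_rel_def)

lemma rc_carrier: "carrier (rc_ring \<rho>) = rc_class \<rho> ` moderate_nets \<rho>"
  by (auto simp: rc_ring_def quotient_def rc_class_def)

lemma rc_class_carrier: "x \<in> moderate_nets \<rho> \<Longrightarrow> rc_class \<rho> x \<in> carrier (rc_ring \<rho>)"
  by (simp add: rc_carrier)

lemma rc_carrierE:
  assumes "X \<in> carrier (rc_ring \<rho>)"
  obtains x where "x \<in> moderate_nets \<rho>" "X = rc_class \<rho> x"
  using assms by (auto simp: rc_carrier)

lemma rc_zero: "\<zero>\<^bsub>rc_ring \<rho>\<^esub> = rc_class \<rho> (\<lambda>_. 0)"
  and rc_one: "\<one>\<^bsub>rc_ring \<rho>\<^esub> = rc_class \<rho> (\<lambda>_. 1)"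
  by (simp_all add: rc_ring_def)

lemma rc_add:
  assumes "gauge_net \<rho>" "x \<in> moderate_nets \<rho>" "y \<in> moderate_nets \<rho>"
  shows "rc_class \<rho> x \<oplus>\<^bsub>rc_ring \<rho>\<^esub> rc_class \<rho> y = rc_class \<rho> (\<lambda>\<epsilon>. x \<epsilon> + y \<epsilon>)"
proof -
  have "rc_class \<rho> (\<lambda>\<epsilon>. x' \<epsilon> + y' \<epsilon>) = rc_class \<rho> (\<lambda>\<epsilon>. x \<epsilon> + y \<epsilon>)"
    if "x' \<in> rc_class \<rho> x" "y' \<in> rc_class \<rho> y" for x' y'
  proof -
    have *: "x' \<in> moderate_nets \<rho>" "net_sim \<rho> x' x" "y' \<in> moderate_nets \<rho>" "net_sim \<rho> y' y"
      using that by (simp_all add: mem_rc_class_iff net_sim_sym)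
    then have "net_sim \<rho> (\<lambda>\<epsilon>. x' \<epsilon> + y' \<epsilon>) (\<lambda>\<epsilon>. x \<epsilon> + y \<epsilon>)"
      using assms by (intro net_sim_add)
    then show ?thesis
      using * assms by (simp add: rc_class_eq_iff moderate_add)
  qed
  then have "(\<Union>x'\<in>rc_class \<rho> x. \<Union>y'\<in>rc_class \<rho> y. rc_class \<rho> (\<lambda>\<epsilon>. x' \<epsilon> + y' \<epsilon>)) =
      rc_class \<rho> (\<lambda>\<epsilon>. x \<epsilon> + y \<epsilon>)"
    using rc_class_self[OF assms(1,2)] rc_class_self[OF assms(1,3)] by blast
  then show ?thesis
    by (simp add: rc_ring_def)
qed

lemma rc_mult:
  assumes "gauge_net \<rho>" "x \<in> moderate_nets \<rho>" "y \<in> moderate_nets \<rho>"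
  shows "rc_class \<rho> x \<otimes>\<^bsub>rc_ring \<rho>\<^esub> rc_class \<rho> y = rc_class \<rho> (\<lambda>\<epsilon>. x \<epsilon> * y \<epsilon>)"
proof -
  have "rc_class \<rho> (\<lambda>\<epsilon>. x' \<epsilon> * y' \<epsilon>) = rc_class \<rho> (\<lambda>\<epsilon>. x \<epsilon> * y \<epsilon>)"
    if "x' \<in> rc_class \<rho> x" "y' \<in> rc_class \<rho> y" for x' y'
  proof -
    have *: "x' \<in> moderate_nets \<rho>" "net_sim \<rho> x' x" "y' \<in> moderate_nets \<rho>" "net_sim \<rho> y' y"
      using that by (simp_all add: mem_rc_class_iff net_sim_sym)
    then have "net_sim \<rho> (\<lambda>\<epsilon>. x' \<epsilon> * y' \<epsilon>) (\<lambda>\<epsilon>. x \<epsilon> * y \<epsilon>)"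
      using assms by (intro net_sim_mult)
    then show ?thesis
      using * assms by (simp add: rc_class_eq_iff moderate_mult)
  qed
  then have "(\<Union>x'\<in>rc_class \<rho> x. \<Union>y'\<in>rc_class \<rho> y. rc_class \<rho> (\<lambda>\<epsilon>. x' \<epsilon> * y' \<epsilon>)) =
      rc_class \<rho> (\<lambda>\<epsilon>. x \<epsilon> * y \<epsilon>)"
    using rc_class_self[OF assms(1,2)] rc_class_self[OF assms(1,3)] by blast
  then show ?thesis
    by (simp add: rc_ring_def)
qed

lemma cring_rc_ring:
  assumes g: "gauge_net \<rho>"
  shows "cring (rc_ring \<rho>)"
proof (rule cringI)
  note ops = rc_add rc_mult moderate_add moderate_mult moderate_const g rc_zero rc_one
  show "abelian_group (rc_ring \<rho>)"
  proof (rule abelian_groupI)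
    fix X assume "X \<in> carrier (rc_ring \<rho>)"
    then obtain x where x: "x \<in> moderate_nets \<rho>" "X = rc_class \<rho> x"
      by (rule rc_carrierE)
    have "rc_class \<rho> (\<lambda>\<epsilon>. - x \<epsilon>) \<in> carrier (rc_ring \<rho>)"
      using x by (simp add: rc_class_carrier moderate_minus)
    moreover have "rc_class \<rho> (\<lambda>\<epsilon>. - x \<epsilon>) \<oplus>\<^bsub>rc_ring \<rho>\<^esub> X = \<zero>\<^bsub>rc_ring \<rho>\<^esub>"
      using x by (simp add: ops moderate_minus)
    ultimately show "\<exists>Y\<in>carrier (rc_ring \<rho>). Y \<oplus>\<^bsub>rc_ring \<rho>\<^esub> X = \<zero>\<^bsub>rc_ring \<rho>\<^esub>"
      by blast
  qed (auto elim!: rc_carrierE simp: ops rc_class_carrier add_ac)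
  show "comm_monoid (rc_ring \<rho>)"
    by (rule comm_monoidI) (auto elim!: rc_carrierE simp: ops rc_class_carrier mult_ac)
qed (auto elim!: rc_carrierE simp: rc_add rc_mult moderate_add moderate_mult g algebra_simps)

lemma rc_minus:
  assumes g: "gauge_net \<rho>" and x: "x \<in> moderate_nets \<rho>" and y: "y \<in> moderate_nets \<rho>"
  shows "rc_class \<rho> x \<ominus>\<^bsub>rc_ring \<rho>\<^esub> rc_class \<rho> y = rc_class \<rho> (\<lambda>\<epsilon>. x \<epsilon> - y \<epsilon>)"
proof -
  interpret cring "rc_ring \<rho>"
    by (rule cring_rc_ring[OF g])
  have "\<ominus>\<^bsub>rc_ring \<rho>\<^esub> rc_class \<rho> y = rc_class \<rho> (\<lambda>\<epsilon>. - y \<epsilon>)"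
    by (rule minus_equality)
       (use g y in \<open>auto simp: rc_add moderate_minus rc_zero rc_class_carrier\<close>)
  then show ?thesis
    using g x y by (simp add: a_minus_def rc_add moderate_minus)
qed

definition rc_abs :: "(real \<Rightarrow> real) \<Rightarrow> (real \<Rightarrow> real) set \<Rightarrow> (real \<Rightarrow> real) set" where
  "rc_abs \<rho> X = (\<Union>x\<in>X. rc_class \<rho> (\<lambda>\<epsilon>. \<bar>x \<epsilon>\<bar>))"

lemma rc_abs:
  assumes "gauge_net \<rho>" "x \<in> moderate_nets \<rho>"
  shows "rc_abs \<rho> (rc_class \<rho> x) = rc_class \<rho> (\<lambda>\<epsilon>. \<bar>x \<epsilon>\<bar>)"
proof -
  have "rc_class \<rho> (\<lambda>\<epsilon>. \<bar>x' \<epsilon>\<bar>) = rc_class \<rho> (\<lambda>\<epsilon>. \<bar>x \<epsilon>\<bar>)" if "x' \<in> rc_class \<rho> x" for x'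
  proof -
    have *: "x' \<in> moderate_nets \<rho>" "net_sim \<rho> x' x"
      using that by (simp_all add: mem_rc_class_iff net_sim_sym)
    then have "net_sim \<rho> (\<lambda>\<epsilon>. \<bar>x' \<epsilon>\<bar>) (\<lambda>\<epsilon>. \<bar>x \<epsilon>\<bar>)"
      using assms by (intro net_sim_abs)
    then show ?thesis
      using * assms by (simp add: rc_class_eq_iff moderate_abs)
  qed
  then show ?thesis
    unfolding rc_abs_def using rc_class_self[OF assms] by blast
qed

definition rc_le :: "(real \<Rightarrow> real) \<Rightarrow> (real \<Rightarrow> real) set \<Rightarrow> (real \<Rightarrow> real) set \<Rightarrow> bool" where
  "rc_le \<rho> X Y \<longleftrightarrow>
    (\<exists>x\<in>X. \<exists>y\<in>Y. \<exists>z. negligible_net \<rho> z \<and> (\<forall>\<^sub>F \<epsilon> in at_right 0. x \<epsilon> \<le> y \<epsilon> + z \<epsilon>))"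

lemma rc_le:
  assumes g: "gauge_net \<rho>" and x: "x \<in> moderate_nets \<rho>" and y: "y \<in> moderate_nets \<rho>"
  shows "rc_le \<rho> (rc_class \<rho> x) (rc_class \<rho> y) \<longleftrightarrow>
    (\<exists>z. negligible_net \<rho> z \<and> (\<forall>\<^sub>F \<epsilon> in at_right 0. x \<epsilon> \<le> y \<epsilon> + z \<epsilon>))"
proof
  assume "rc_le \<rho> (rc_class \<rho> x) (rc_class \<rho> y)"
  then obtain x' y' z where s: "net_sim \<rho> x x'" "net_sim \<rho> y y'" and z: "net_sim \<rho> z (\<lambda>_. 0)"
    and le: "\<forall>\<^sub>F \<epsilon> in at_right 0. x' \<epsilon> \<le> y' \<epsilon> + z \<epsilon>"
    by (auto simp: rc_le_def mem_rc_class_iff negligible_net_def)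
  define w where "w = (\<lambda>\<epsilon>. z \<epsilon> + (\<bar>x \<epsilon> - x' \<epsilon>\<bar> + \<bar>y \<epsilon> - y' \<epsilon>\<bar>))"
  have "net_sim \<rho> (\<lambda>\<epsilon>. \<bar>x \<epsilon> - x' \<epsilon>\<bar> + \<bar>y \<epsilon> - y' \<epsilon>\<bar>) (\<lambda>_. 0)"
    by (rule net_sim_sum[OF g s]) auto
  then have "negligible_net \<rho> w"
    unfolding negligible_net_def w_def using net_sim_add[OF g z] by fastforce
  moreover have "\<forall>\<^sub>F \<epsilon> in at_right 0. x \<epsilon> \<le> y \<epsilon> + w \<epsilon>"
    using le by eventually_elim (auto simp: w_def)
  ultimately show "\<exists>z. negligible_net \<rho> z \<and> (\<forall>\<^sub>F \<epsilon> in at_right 0. x \<epsilon> \<le> y \<epsilon> + z \<epsilon>)"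
    by blast
next
  assume "\<exists>z. negligible_net \<rho> z \<and> (\<forall>\<^sub>F \<epsilon> in at_right 0. x \<epsilon> \<le> y \<epsilon> + z \<epsilon>)"
  then show "rc_le \<rho> (rc_class \<rho> x) (rc_class \<rho> y)"
    unfolding rc_le_def using rc_class_self[OF g x] rc_class_self[OF g y] by blast
qed

definition rc_less :: "(real \<Rightarrow> real) \<Rightarrow> (real \<Rightarrow> real) set \<Rightarrow> (real \<Rightarrow> real) set \<Rightarrow> bool" where
  "rc_less \<rho> X Y \<longleftrightarrow> rc_le \<rho> X Y \<and> Y \<ominus>\<^bsub>rc_ring \<rho>\<^esub> X \<in> Units (rc_ring \<rho>)"

lemma rc_less_iff:
  assumes g: "gauge_net \<rho>" and x: "x \<in> moderate_nets \<rho>" and y: "y \<in> moderate_nets \<rho>"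
  shows "rc_less \<rho> (rc_class \<rho> x) (rc_class \<rho> y) \<longleftrightarrow>
    (\<exists>m::nat. \<forall>\<^sub>F \<epsilon> in at_right 0. \<rho> \<epsilon> ^ m \<le> y \<epsilon> - x \<epsilon>)"
proof
  assume "rc_less \<rho> (rc_class \<rho> x) (rc_class \<rho> y)"
  then have le: "rc_le \<rho> (rc_class \<rho> x) (rc_class \<rho> y)"
    and u: "rc_class \<rho> (\<lambda>\<epsilon>. y \<epsilon> - x \<epsilon>) \<in> Units (rc_ring \<rho>)"
    using g x y by (auto simp: rc_less_def rc_minus)
  obtain z where z: "net_sim \<rho> z (\<lambda>_. 0)" "\<forall>\<^sub>F \<epsilon> in at_right 0. x \<epsilon> \<le> y \<epsilon> + z \<epsilon>"
    using le g x y by (auto simp: rc_le negligible_net_def)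
  obtain w where w: "w \<in> moderate_nets \<rho>"
    "rc_class \<rho> (\<lambda>\<epsilon>. y \<epsilon> - x \<epsilon>) \<otimes>\<^bsub>rc_ring \<rho>\<^esub> rc_class \<rho> w = \<one>\<^bsub>rc_ring \<rho>\<^esub>"
    using u by (auto simp: Units_def rc_carrier)
  then have "net_sim \<rho> (\<lambda>\<epsilon>. (y \<epsilon> - x \<epsilon>) * w \<epsilon>) (\<lambda>_. 1)"
    using g x y
    by (simp add: rc_mult rc_one moderate_diff rc_class_eq_iff moderate_mult moderate_const)
  then have "\<forall>\<^sub>F \<epsilon> in at_right 0. \<bar>(y \<epsilon> - x \<epsilon>) * w \<epsilon> - 1\<bar> \<le> \<rho> \<epsilon> ^ 1"
    unfolding net_sim_def by blast
  moreover obtain N where "\<forall>\<^sub>F \<epsilon> in at_right 0. \<bar>w \<epsilon>\<bar> * \<rho> \<epsilon> ^ N \<le> 1"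
    using moderate_netsE[OF g w(1)] .
  moreover have "\<forall>\<^sub>F \<epsilon> in at_right 0. \<bar>z \<epsilon> - 0\<bar> \<le> \<rho> \<epsilon> ^ (N + 2)"
    using z(1) unfolding net_sim_def by blast
  ultimately have "\<forall>\<^sub>F \<epsilon> in at_right 0. \<rho> \<epsilon> ^ (N + 1) \<le> y \<epsilon> - x \<epsilon>"
    using z(2) gauge_net_eventually[OF g]
  proof eventually_elim
    case (elim \<epsilon>)
    let ?d = "y \<epsilon> - x \<epsilon>"
    have "1 / 2 \<le> \<bar>?d\<bar> * \<bar>w \<epsilon>\<bar>"
      using elim unfolding abs_mult[symmetric] power_one_right by linarith
    then have "\<rho> \<epsilon> ^ N * (1 / 2) \<le> \<rho> \<epsilon> ^ N * (\<bar>?d\<bar> * \<bar>w \<epsilon>\<bar>)"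
      using elim by (intro mult_left_mono) auto
    also have "\<dots> = \<bar>?d\<bar> * (\<bar>w \<epsilon>\<bar> * \<rho> \<epsilon> ^ N)"
      by simp
    also have "\<dots> \<le> \<bar>?d\<bar> * 1"
      using elim by (intro mult_left_mono) auto
    finally have 1: "\<rho> \<epsilon> ^ N / 2 \<le> \<bar>?d\<bar>"
      by simp
    have 2: "\<rho> \<epsilon> ^ N * \<rho> \<epsilon> \<le> \<rho> \<epsilon> ^ N * (1 / 2)"
      using elim by (intro mult_left_mono) auto
    have 3: "\<rho> \<epsilon> ^ N * \<rho> \<epsilon> * \<rho> \<epsilon> < \<rho> \<epsilon> ^ N * \<rho> \<epsilon> * 1"
      using elim by (intro mult_strict_left_mono) auto
    have 4: "- ?d \<le> \<rho> \<epsilon> ^ N * \<rho> \<epsilon> * \<rho> \<epsilon>"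
      using elim by (simp add: power2_eq_square mult_ac)
    show ?case
      using 1 2 3 4 unfolding power_add power_one_right by linarith
  qed
  then show "\<exists>m::nat. \<forall>\<^sub>F \<epsilon> in at_right 0. \<rho> \<epsilon> ^ m \<le> y \<epsilon> - x \<epsilon>"
    by blast
next
  assume "\<exists>m::nat. \<forall>\<^sub>F \<epsilon> in at_right 0. \<rho> \<epsilon> ^ m \<le> y \<epsilon> - x \<epsilon>"
  then obtain m where m: "\<forall>\<^sub>F \<epsilon> in at_right 0. \<rho> \<epsilon> ^ m \<le> y \<epsilon> - x \<epsilon>"
    by blast
  interpret cring "rc_ring \<rho>"
    by (rule cring_rc_ring[OF g])
  have pos: "\<forall>\<^sub>F \<epsilon> in at_right 0. 0 < y \<epsilon> - x \<epsilon>"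
    using m gauge_net_eventually[OF g]
    by eventually_elim (blast intro: zero_less_power less_le_trans)
  then have "\<forall>\<^sub>F \<epsilon> in at_right 0. x \<epsilon> \<le> y \<epsilon> + 0"
    by eventually_elim simp
  then have "rc_le \<rho> (rc_class \<rho> x) (rc_class \<rho> y)"
    unfolding rc_le[OF g x y] negligible_net_def
    using net_sim_refl[OF g, of "\<lambda>_. 0"] by blast
  define w where "w = (\<lambda>\<epsilon>. inverse (y \<epsilon> - x \<epsilon>))"
  have "\<forall>\<^sub>F \<epsilon> in at_right 0. \<bar>w \<epsilon>\<bar> * \<rho> \<epsilon> ^ m \<le> 1"
    using m pos by eventually_elim (simp add: w_def field_simps)
  then have w: "w \<in> moderate_nets \<rho>"
    by (rule moderate_netsI[OF g])
  have "net_sim \<rho> (\<lambda>\<epsilon>. (y \<epsilon> - x \<epsilon>) * w \<epsilon>) (\<lambda>_. 1)"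
    by (rule net_sim_eventually_eq[OF g])
       (use pos in eventually_elim, simp add: w_def)
  then have "rc_class \<rho> (\<lambda>\<epsilon>. y \<epsilon> - x \<epsilon>) \<otimes>\<^bsub>rc_ring \<rho>\<^esub> rc_class \<rho> w = \<one>\<^bsub>rc_ring \<rho>\<^esub>"
    using g x y w
    by (simp add: rc_mult rc_one moderate_diff rc_class_eq_iff moderate_mult moderate_const)
  moreover have c: "rc_class \<rho> w \<in> carrier (rc_ring \<rho>)"
    "rc_class \<rho> (\<lambda>\<epsilon>. y \<epsilon> - x \<epsilon>) \<in> carrier (rc_ring \<rho>)"
    using g x y w by (simp_all add: rc_class_carrier moderate_diff)
  ultimately have "rc_class \<rho> (\<lambda>\<epsilon>. y \<epsilon> - x \<epsilon>) \<in> Units (rc_ring \<rho>)"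
    unfolding Units_def mem_Collect_eq using m_comm[OF c] c by (metis (no_types))
  then show "rc_less \<rho> (rc_class \<rho> x) (rc_class \<rho> y)"
    using \<open>rc_le \<rho> (rc_class \<rho> x) (rc_class \<rho> y)\<close> g x y by (simp add: rc_less_def rc_minus)
qed

definition sharp_ball ::
    "(real \<Rightarrow> real) \<Rightarrow> (real \<Rightarrow> real) set \<Rightarrow> (real \<Rightarrow> real) set \<Rightarrow> (real \<Rightarrow> real) set set" where
  "sharp_ball \<rho> X r =
    {Y \<in> carrier (rc_ring \<rho>). rc_less \<rho> (rc_abs \<rho> (Y \<ominus>\<^bsub>rc_ring \<rho>\<^esub> X)) r}"

definition sharp_balls :: "(real \<Rightarrow> real) \<Rightarrow> (real \<Rightarrow> real) set set set" where
  "sharp_balls \<rho> =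
    {sharp_ball \<rho> X r | X r. X \<in> carrier (rc_ring \<rho>) \<and> r \<in> carrier (rc_ring \<rho>)
      \<and> rc_less \<rho> \<zero>\<^bsub>rc_ring \<rho>\<^esub> r}"

text \<open>
  The balls are used as a subbase here; by \<open>openin_sharp_topology\<close> below they are already a base.
\<close>

definition sharp_topology :: "(real \<Rightarrow> real) \<Rightarrow> (real \<Rightarrow> real) set topology" where
  "sharp_topology \<rho> = topology_generated_by (sharp_balls \<rho>)"

lemma sharp_ball_iff:
  assumes "gauge_net \<rho>" "x \<in> moderate_nets \<rho>" "y \<in> moderate_nets \<rho>" "r \<in> moderate_nets \<rho>"
  shows "rc_class \<rho> y \<in> sharp_ball \<rho> (rc_class \<rho> x) (rc_class \<rho> r) \<longleftrightarrow>
    (\<exists>m::nat. \<forall>\<^sub>F \<epsilon> in at_right 0. \<rho> \<epsilon> ^ m \<le> r \<epsilon> - \<bar>y \<epsilon> - x \<epsilon>\<bar>)"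
proof -
  have d: "(\<lambda>\<epsilon>. y \<epsilon> - x \<epsilon>) \<in> moderate_nets \<rho>"
    using assms by (intro moderate_diff)
  show ?thesis
    using assms(3)
    by (simp add: sharp_ball_def rc_class_carrier rc_minus[OF assms(1,3,2)] rc_abs[OF assms(1) d]
        rc_less_iff[OF assms(1) moderate_abs[OF d] assms(4)])
qed

lemma moderate_gauge_power:
  assumes "gauge_net \<rho>"
  shows "(\<lambda>\<epsilon>. \<rho> \<epsilon> ^ m) \<in> moderate_nets \<rho>"
proof (rule moderate_bounded[OF assms])
  show "\<forall>\<^sub>F \<epsilon> in at_right 0. \<bar>\<rho> \<epsilon> ^ m\<bar> \<le> 1"
    using gauge_net_eventually[OF assms] by eventually_elim (simp add: power_le_one)
qed

lemma centered_sharp_ball: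
  assumes g: "gauge_net \<rho>" and "x \<in> moderate_nets \<rho>"
  shows "rc_class \<rho> x \<in> sharp_ball \<rho> (rc_class \<rho> x) (rc_class \<rho> (\<lambda>\<epsilon>. \<rho> \<epsilon> ^ m))"
    and "sharp_ball \<rho> (rc_class \<rho> x) (rc_class \<rho> (\<lambda>\<epsilon>. \<rho> \<epsilon> ^ m)) \<in> sharp_balls \<rho>"
proof -
  show "rc_class \<rho> x \<in> sharp_ball \<rho> (rc_class \<rho> x) (rc_class \<rho> (\<lambda>\<epsilon>. \<rho> \<epsilon> ^ m))"
    unfolding sharp_ball_iff[OF g assms(2,2) moderate_gauge_power[OF g]]
    by (intro exI[of _ m]) simp
  have "rc_less \<rho> \<zero>\<^bsub>rc_ring \<rho>\<^esub> (rc_class \<rho> (\<lambda>\<epsilon>. \<rho> \<epsilon> ^ m))"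
    unfolding rc_zero rc_less_iff[OF g moderate_const(1)[OF g] moderate_gauge_power[OF g]]
    by (intro exI[of _ m]) simp
  then show "sharp_ball \<rho> (rc_class \<rho> x) (rc_class \<rho> (\<lambda>\<epsilon>. \<rho> \<epsilon> ^ m)) \<in> sharp_balls \<rho>"
    unfolding sharp_balls_def
    using rc_class_carrier[OF assms(2)] rc_class_carrier[OF moderate_gauge_power[OF g]] by blast
qed

lemma sharp_ball_contains_centered:
  assumes g: "gauge_net \<rho>" and x: "x \<in> moderate_nets \<rho>" and B: "B \<in> sharp_balls \<rho>"
    and xB: "rc_class \<rho> x \<in> B"
  shows "\<exists>m0. \<forall>m\<ge>m0. sharp_ball \<rho> (rc_class \<rho> x) (rc_class \<rho> (\<lambda>\<epsilon>. \<rho> \<epsilon> ^ m)) \<subseteq> B"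
proof -
  obtain c r where c: "c \<in> moderate_nets \<rho>" and r: "r \<in> moderate_nets \<rho>"
    and B_eq: "B = sharp_ball \<rho> (rc_class \<rho> c) (rc_class \<rho> r)"
    using B by (auto simp: sharp_balls_def rc_carrier)
  obtain k :: nat where k: "\<forall>\<^sub>F \<epsilon> in at_right 0. \<rho> \<epsilon> ^ k \<le> r \<epsilon> - \<bar>x \<epsilon> - c \<epsilon>\<bar>"
    using xB g x c r by (auto simp: B_eq sharp_ball_iff)
  have "sharp_ball \<rho> (rc_class \<rho> x) (rc_class \<rho> (\<lambda>\<epsilon>. \<rho> \<epsilon> ^ m)) \<subseteq> B" if "m \<ge> k" for m
  proof
    fix Y assume Y: "Y \<in> sharp_ball \<rho> (rc_class \<rho> x) (rc_class \<rho> (\<lambda>\<epsilon>. \<rho> \<epsilon> ^ m))"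
    then obtain y where y: "y \<in> moderate_nets \<rho>" "Y = rc_class \<rho> y"
      by (auto simp: sharp_ball_def elim: rc_carrierE)
    obtain j :: nat where "\<forall>\<^sub>F \<epsilon> in at_right 0. \<rho> \<epsilon> ^ j \<le> \<rho> \<epsilon> ^ m - \<bar>y \<epsilon> - x \<epsilon>\<bar>"
      using Y y g x by (auto simp: sharp_ball_iff moderate_gauge_power)
    then have "\<forall>\<^sub>F \<epsilon> in at_right 0. \<rho> \<epsilon> ^ j \<le> r \<epsilon> - \<bar>y \<epsilon> - c \<epsilon>\<bar>"
      using k gauge_net_eventually[OF g]
    proof eventually_elim
      case (elim \<epsilon>)
      have "\<rho> \<epsilon> ^ m \<le> \<rho> \<epsilon> ^ k"
        using elim that by (intro power_decreasing) auto
      then show ?case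
        using elim by linarith
    qed
    then show "Y \<in> B"
      using g c r y by (auto simp: B_eq sharp_ball_iff)
  qed
  then show ?thesis
    by blast
qed

lemma openin_sharp_topology:
  assumes g: "gauge_net \<rho>"
  shows "openin (sharp_topology \<rho>) = arbitrary union_of (\<lambda>B. B \<in> sharp_balls \<rho>)"
  unfolding openin_topology_base_unique
proof (intro conjI allI impI)
  show "openin (sharp_topology \<rho>) B" if "B \<in> sharp_balls \<rho>" for B
    using that by (simp add: sharp_topology_def topology_generated_by_Basis)
next
  fix U X
  assume UX: "openin (sharp_topology \<rho>) U \<and> X \<in> U"
  then have "generate_topology_on (sharp_balls \<rho>) U"
    by (simp add: sharp_topology_def openin_topology_generated_by_iff)
  then have *: "\<exists>m0. \<forall>m\<ge>m0. sharp_ball \<rho> (rc_class \<rho> x) (rc_class \<rho> (\<lambda>\<epsilon>. \<rho> \<epsilon> ^ m)) \<subseteq> U"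
    if "x \<in> moderate_nets \<rho>" "rc_class \<rho> x \<in> U" for x
    using that
  proof (induction arbitrary: x)
    case (Int U V)
    then obtain m1 m2 where
      "\<forall>m\<ge>m1. sharp_ball \<rho> (rc_class \<rho> x) (rc_class \<rho> (\<lambda>\<epsilon>. \<rho> \<epsilon> ^ m)) \<subseteq> U"
      "\<forall>m\<ge>m2. sharp_ball \<rho> (rc_class \<rho> x) (rc_class \<rho> (\<lambda>\<epsilon>. \<rho> \<epsilon> ^ m)) \<subseteq> V"
      by blast
    then show ?case
      by (intro exI[of _ "max m1 m2"]) auto
  next
    case (UN K)
    then show ?case
      by (meson UnionE Union_upper subset_trans)
  next
    case (Basis B)
    then show ?case
      using sharp_ball_contains_centered[OF g] by blast
  qed auto
  have "U \<subseteq> topspace (sharp_topology \<rho>)"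
    using UX by (simp add: openin_subset)
  also have "\<dots> \<subseteq> carrier (rc_ring \<rho>)"
    by (auto simp: sharp_topology_def sharp_balls_def sharp_ball_def)
  finally obtain x where "x \<in> moderate_nets \<rho>" "X = rc_class \<rho> x"
    using UX by (auto elim: rc_carrierE)
  then show "\<exists>B. B \<in> sharp_balls \<rho> \<and> X \<in> B \<and> B \<subseteq> U"
    using * centered_sharp_ball[OF g] UX by blast
qed

lemma topspace_sharp_topology:
  assumes g: "gauge_net \<rho>"
  shows "topspace (sharp_topology \<rho>) = carrier (rc_ring \<rho>)"
  unfolding sharp_topology_def topology_generated_by_topspace
proof
  show "\<Union> (sharp_balls \<rho>) \<subseteq> carrier (rc_ring \<rho>)"
    by (auto simp: sharp_balls_def sharp_ball_def)
  show "carrier (rc_ring \<rho>) \<subseteq> \<Union> (sharp_balls \<rho>)"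
    using centered_sharp_ball[OF g] by (blast elim: rc_carrierE)
qed

definition hypernats :: "(real \<Rightarrow> real) \<Rightarrow> (real \<Rightarrow> real) set set" where
  "hypernats \<sigma> = {rc_class \<sigma> n | n. n \<in> moderate_nets \<sigma> \<and> (\<forall>\<epsilon>\<in>{0<..1}. n \<epsilon> \<in> \<nat>)}"

definition hypernats_ge :: "(real \<Rightarrow> real) \<Rightarrow> (real \<Rightarrow> real) set \<Rightarrow> (real \<Rightarrow> real) set set" where
  "hypernats_ge \<sigma> N = {n \<in> hypernats \<sigma>. rc_le \<sigma> N n}"

definition hypersequences ::
    "(real \<Rightarrow> real) \<Rightarrow> (real \<Rightarrow> real) \<Rightarrow> ((real \<Rightarrow> real) set \<Rightarrow> (real \<Rightarrow> real) set) set" where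
  "hypersequences \<sigma> \<rho> = hypernats \<sigma> \<rightarrow> carrier (rc_ring \<rho>)"

definition is_hyperlimit ::
    "(real \<Rightarrow> real) \<Rightarrow> (real \<Rightarrow> real) \<Rightarrow> ((real \<Rightarrow> real) set \<Rightarrow> (real \<Rightarrow> real) set) \<Rightarrow>
      (real \<Rightarrow> real) set \<Rightarrow> bool" where
  "is_hyperlimit \<sigma> \<rho> x l \<longleftrightarrow> l \<in> carrier (rc_ring \<rho>) \<and>
    (\<forall>q::nat. \<exists>M\<in>hypernats \<sigma>. \<forall>n\<in>hypernats_ge \<sigma> M.
      rc_less \<rho> (rc_abs \<rho> (x n \<ominus>\<^bsub>rc_ring \<rho>\<^esub> l)) (rc_class \<rho> \<rho> [^]\<^bsub>rc_ring \<rho>\<^esub> q))"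

end

theory Submission
  imports Defs
begin

text \<open>
  Hypernaturals are directed, so a hypernatural index \<open>n\<close> can be chosen beyond finitely many
  thresholds at once. If \<open>l\<close> were outside of \<open>C\<close>, then so would be a ball of some radius
  \<open>\<rho>\<^sup>q\<close> around \<open>l\<close>, yet this ball contains \<open>x\<^sub>n \<in> C\<close>. For the inequality, every \<open>q\<close> admits an
  index \<open>n\<close> with \<open>k \<le> y\<^sub>n + \<rho>\<^sup>q \<le> x\<^sub>n + 2 \<rho>\<^sup>q \<le> l + 3 \<rho>\<^sup>q\<close> up to negligible nets, and an
  excess \<open>k - l\<close> below every power of \<open>\<rho>\<close> has negligible positive part.
\<close>

text \<open>Trades the existentially quantified negligible net for one error bound per power of the
  gauge. In this form inequalities of classes combine with the errors
  \<open>\<rho> \<epsilon> ^ q\<close> that come from sharp balls.\<close>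

lemma rc_le_iff_power:
  assumes g: "gauge_net \<rho>" and x: "x \<in> moderate_nets \<rho>" and y: "y \<in> moderate_nets \<rho>"
  shows "rc_le \<rho> (rc_class \<rho> x) (rc_class \<rho> y) \<longleftrightarrow>
    (\<forall>q::nat. \<forall>\<^sub>F \<epsilon> in at_right 0. x \<epsilon> \<le> y \<epsilon> + \<rho> \<epsilon> ^ q)"
  unfolding rc_le[OF g x y]
proof
  assume "\<exists>z. negligible_net \<rho> z \<and> (\<forall>\<^sub>F \<epsilon> in at_right 0. x \<epsilon> \<le> y \<epsilon> + z \<epsilon>)"
  then obtain z where z: "\<And>q. \<forall>\<^sub>F \<epsilon> in at_right 0. \<bar>z \<epsilon> - 0\<bar> \<le> \<rho> \<epsilon> ^ q"
    and le: "\<forall>\<^sub>F \<epsilon> in at_right 0. x \<epsilon> \<le> y \<epsilon> + z \<epsilon>"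
    unfolding negligible_net_def net_sim_def by blast
  show "\<forall>q. \<forall>\<^sub>F \<epsilon> in at_right 0. x \<epsilon> \<le> y \<epsilon> + \<rho> \<epsilon> ^ q"
  proof
    fix q
    show "\<forall>\<^sub>F \<epsilon> in at_right 0. x \<epsilon> \<le> y \<epsilon> + \<rho> \<epsilon> ^ q"
      using z[of q] le by eventually_elim linarith
  qed
next
  assume *: "\<forall>q. \<forall>\<^sub>F \<epsilon> in at_right 0. x \<epsilon> \<le> y \<epsilon> + \<rho> \<epsilon> ^ q"
  \<comment> \<open>The witness is the positive part of \<open>x - y\<close>: where it is nonzero
    the assumption bounds it by \<open>\<rho> \<epsilon> ^ q\<close>, elsewhere it is 0 and
    positivity of the power suffices.\<close>
  have "\<forall>\<^sub>F \<epsilon> in at_right 0. \<bar>max 0 (x \<epsilon> - y \<epsilon>) - 0\<bar> \<le> \<rho> \<epsilon> ^ q" for q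
    using *[rule_format, of q] gauge_net_eventually[OF g]
  proof eventually_elim
    case (elim \<epsilon>)
    then have "0 < \<rho> \<epsilon> ^ q"
      by simp
    then show ?case
      using elim by linarith
  qed
  then have "negligible_net \<rho> (\<lambda>\<epsilon>. max 0 (x \<epsilon> - y \<epsilon>))"
    by (simp add: negligible_net_def net_sim_def)
  then show "\<exists>z. negligible_net \<rho> z \<and> (\<forall>\<^sub>F \<epsilon> in at_right 0. x \<epsilon> \<le> y \<epsilon> + z \<epsilon>)"
    by (intro exI[of _ "\<lambda>\<epsilon>. max 0 (x \<epsilon> - y \<epsilon>)"]) (simp add: max_def)
qed

lemma rc_le_trans:
  assumes g: "gauge_net \<rho>"
    and X: "X \<in> carrier (rc_ring \<rho>)" and Y: "Y \<in> carrier (rc_ring \<rho>)" and Z: "Z \<in> carrier (rc_ring \<rho>)"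
    and XY: "rc_le \<rho> X Y" and YZ: "rc_le \<rho> Y Z"
  shows "rc_le \<rho> X Z"
proof -
  obtain x y z where nets: "x \<in> moderate_nets \<rho>" "y \<in> moderate_nets \<rho>" "z \<in> moderate_nets \<rho>"
    and classes: "X = rc_class \<rho> x" "Y = rc_class \<rho> y" "Z = rc_class \<rho> z"
    using X Y Z by (auto simp: rc_carrier)
  have "\<forall>\<^sub>F \<epsilon> in at_right 0. x \<epsilon> \<le> z \<epsilon> + \<rho> \<epsilon> ^ q" for q
  proof -
    have "\<forall>\<^sub>F \<epsilon> in at_right 0. x \<epsilon> \<le> y \<epsilon> + \<rho> \<epsilon> ^ Suc q"
      "\<forall>\<^sub>F \<epsilon> in at_right 0. y \<epsilon> \<le> z \<epsilon> + \<rho> \<epsilon> ^ Suc q"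
      using XY YZ nets unfolding classes by (simp_all only: rc_le_iff_power[OF g])
    then show ?thesis
      using gauge_net_eventually[OF g]
    proof eventually_elim
      case (elim \<epsilon>)
      \<comment> \<open>Both inequalities are taken with exponent \<open>Suc q\<close>, since two
        errors \<open>\<rho> \<epsilon> ^ Suc q\<close> add up to at most
        \<open>\<rho> \<epsilon> ^ q\<close> once \<open>\<rho> \<epsilon> < 1 / 2\<close>.\<close>
      have "\<rho> \<epsilon> * \<rho> \<epsilon> ^ q \<le> 1 / 2 * \<rho> \<epsilon> ^ q"
        using elim by (intro mult_right_mono) auto
      then show ?case
        using elim unfolding power_Suc by linarith
    qed
  qed
  then show ?thesis
    using nets unfolding classes by (simp add: rc_le_iff_power[OF g])
qed

lemma hypernats_carrier: "hypernats \<sigma> \<subseteq> carrier (rc_ring \<sigma>)"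
  by (auto simp: hypernats_def rc_carrier)

text \<open>The sum of two natural-valued representatives is moderate, again natural-valued, and
  dominates both summands. Transitivity turns these two bounds into inclusions of the tails.\<close>

lemma hypernats_directed:
  assumes g: "gauge_net \<sigma>" and M: "M \<in> hypernats \<sigma>" and N: "N \<in> hypernats \<sigma>"
  obtains K where "K \<in> hypernats \<sigma>" "hypernats_ge \<sigma> K \<subseteq> hypernats_ge \<sigma> M \<inter> hypernats_ge \<sigma> N"
proof -
  obtain m n where m: "m \<in> moderate_nets \<sigma>" "\<forall>\<epsilon>\<in>{0<..1}. m \<epsilon> \<in> \<nat>" "M = rc_class \<sigma> m"
    and n: "n \<in> moderate_nets \<sigma>" "\<forall>\<epsilon>\<in>{0<..1}. n \<epsilon> \<in> \<nat>" "N = rc_class \<sigma> n"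
    using M N by (auto simp: hypernats_def)
  define K where "K = rc_class \<sigma> (\<lambda>\<epsilon>. m \<epsilon> + n \<epsilon>)"
  have mn: "(\<lambda>\<epsilon>. m \<epsilon> + n \<epsilon>) \<in> moderate_nets \<sigma>"
    using g m n by (simp add: moderate_add)
  have K: "K \<in> hypernats \<sigma>"
    unfolding hypernats_def K_def mem_Collect_eq
    using m n mn by (intro exI[of _ "\<lambda>\<epsilon>. m \<epsilon> + n \<epsilon>"]) simp
  \<comment> \<open>Representatives take natural values on the whole index set, so 1 serves as the
    threshold; outside of it nothing is known about them.\<close>
  have "\<forall>\<^sub>F \<epsilon> in at_right 0. m \<epsilon> \<in> \<nat> \<and> n \<epsilon> \<in> \<nat>"
    unfolding eventually_at_right_0_iff_index using m n by (intro bexI[of _ 1]) auto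
  then have nonneg: "\<forall>\<^sub>F \<epsilon> in at_right 0. 0 \<le> m \<epsilon> \<and> 0 \<le> n \<epsilon>"
    by eventually_elim (auto elim: Nats_cases)
  have zero: "negligible_net \<sigma> (\<lambda>_. 0)"
    using g by (simp add: negligible_net_def net_sim_refl)
  have "\<forall>\<^sub>F \<epsilon> in at_right 0. m \<epsilon> \<le> m \<epsilon> + n \<epsilon> + 0"
    using nonneg by eventually_elim simp
  then have MK: "rc_le \<sigma> M K"
    unfolding m(3) K_def rc_le[OF g m(1) mn] using zero by blast
  have "\<forall>\<^sub>F \<epsilon> in at_right 0. n \<epsilon> \<le> m \<epsilon> + n \<epsilon> + 0"
    using nonneg by eventually_elim simp
  then have NK: "rc_le \<sigma> N K"
    unfolding n(3) K_def rc_le[OF g n(1) mn] using zero by blast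
  have "hypernats_ge \<sigma> K \<subseteq> hypernats_ge \<sigma> M \<inter> hypernats_ge \<sigma> N"
    using rc_le_trans[OF g _ _ _ MK] rc_le_trans[OF g _ _ _ NK] hypernats_carrier[of \<sigma>] M N K
    unfolding hypernats_ge_def by blast
  then show ?thesis
    using K that by blast
qed

text \<open>Shows that tails are nonempty, so a property of a tail can be used at its own
  threshold.\<close>

lemma hypernats_ge_self:
  assumes g: "gauge_net \<sigma>" and "N \<in> hypernats \<sigma>"
  shows "N \<in> hypernats_ge \<sigma> N"
proof -
  obtain n where n: "n \<in> moderate_nets \<sigma>" "N = rc_class \<sigma> n"
    using assms(2) by (auto simp: hypernats_def)
  have "\<forall>\<^sub>F \<epsilon> in at_right 0. n \<epsilon> \<le> n \<epsilon> + \<sigma> \<epsilon> ^ q" for q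
    using gauge_net_eventually[OF g] by eventually_elim simp
  then show ?thesis
    using assms(2) n by (simp add: hypernats_ge_def rc_le_iff_power[OF g])
qed

text \<open>Links the ring power in the definition of the hyperlimit with the radii of the centred
  balls that form neighbourhood bases.\<close>

lemma rc_class_gauge_power:
  assumes g: "gauge_net \<rho>"
  shows "rc_class \<rho> \<rho> [^]\<^bsub>rc_ring \<rho>\<^esub> (q::nat) = rc_class \<rho> (\<lambda>\<epsilon>. \<rho> \<epsilon> ^ q)"
proof (induction q)
  case 0
  then show ?case
    by (simp add: rc_one)
next
  case (Suc q)
  have "\<rho> \<in> moderate_nets \<rho>"
    using moderate_gauge_power[OF g, of 1] by simp
  then show ?case
    using Suc g by (simp add: rc_mult moderate_gauge_power mult.commute)
qed

lemma is_hyperlimitE: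
  assumes "gauge_net \<rho>" and "x \<in> hypersequences \<sigma> \<rho>" and "is_hyperlimit \<sigma> \<rho> x l"
  obtains M where "M \<in> hypernats \<sigma>"
    "\<And>n. n \<in> hypernats_ge \<sigma> M \<Longrightarrow> x n \<in> sharp_ball \<rho> l (rc_class \<rho> (\<lambda>\<epsilon>. \<rho> \<epsilon> ^ q))"
proof -
  obtain M where "M \<in> hypernats \<sigma>" "\<forall>n\<in>hypernats_ge \<sigma> M.
      rc_less \<rho> (rc_abs \<rho> (x n \<ominus>\<^bsub>rc_ring \<rho>\<^esub> l)) (rc_class \<rho> (\<lambda>\<epsilon>. \<rho> \<epsilon> ^ q))"
    using assms(3) unfolding is_hyperlimit_def rc_class_gauge_power[OF assms(1)] by blast
  then show ?thesis
    using assms(2) by (intro that[of M]) (auto simp: sharp_ball_def hypersequences_def hypernats_ge_def)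
qed

text \<open>Membership in the ball provides a gap \<open>\<rho> \<epsilon> ^ m\<close> with some
  \<open>m\<close>; only the positivity of this gap is kept.\<close>

lemma sharp_ball_power_dist:
  assumes g: "gauge_net \<rho>" and "x \<in> moderate_nets \<rho>" and "y \<in> moderate_nets \<rho>"
    and "rc_class \<rho> y \<in> sharp_ball \<rho> (rc_class \<rho> x) (rc_class \<rho> (\<lambda>\<epsilon>. \<rho> \<epsilon> ^ q))"
  shows "\<forall>\<^sub>F \<epsilon> in at_right 0. \<bar>y \<epsilon> - x \<epsilon>\<bar> \<le> \<rho> \<epsilon> ^ q"
proof -
  obtain m :: nat where "\<forall>\<^sub>F \<epsilon> in at_right 0. \<rho> \<epsilon> ^ m \<le> \<rho> \<epsilon> ^ q - \<bar>y \<epsilon> - x \<epsilon>\<bar>"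
    using assms by (auto simp: sharp_ball_iff moderate_gauge_power)
  then show ?thesis
    using gauge_net_eventually[OF g]
  proof eventually_elim
    case (elim \<epsilon>)
    then have "0 < \<rho> \<epsilon> ^ m"
      by simp
    then show ?case
      using elim by linarith
  qed
qed

lemma hyperlimit_in_closedin:
  assumes g: "gauge_net \<rho>" and s: "gauge_net \<sigma>"
    and x: "x \<in> hypersequences \<sigma> \<rho>" and lim: "is_hyperlimit \<sigma> \<rho> x l"
    and C: "closedin (sharp_topology \<rho>) C"
    and N: "N \<in> hypernats \<sigma>" "\<And>n. n \<in> hypernats_ge \<sigma> N \<Longrightarrow> x n \<in> C"
  shows "l \<in> C"
proof (rule ccontr)
  assume "l \<notin> C"
  obtain l' where l': "l' \<in> moderate_nets \<rho>" "l = rc_class \<rho> l'"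
    using lim by (auto simp: is_hyperlimit_def rc_carrier)
  have "openin (sharp_topology \<rho>) (carrier (rc_ring \<rho>) - C)"
    using C by (simp add: closedin_def topspace_sharp_topology[OF g])
  moreover have "l \<in> carrier (rc_ring \<rho>) - C"
    using \<open>l \<notin> C\<close> lim by (simp add: is_hyperlimit_def)
  ultimately obtain B where B: "B \<in> sharp_balls \<rho>" "l \<in> B" "B \<subseteq> carrier (rc_ring \<rho>) - C"
    unfolding openin_sharp_topology[OF g] arbitrary_union_of_alt by blast
  \<comment> \<open>The base element \<open>B\<close> may be centred elsewhere; it is replaced by a
    smaller ball centred at \<open>l\<close> whose radius is a power of the gauge, as convergence
    requires.\<close>
  then obtain q where q: "sharp_ball \<rho> l (rc_class \<rho> (\<lambda>\<epsilon>. \<rho> \<epsilon> ^ q)) \<subseteq> B"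
    using sharp_ball_contains_centered[OF g l'(1)] l'(2) by blast
  obtain M where M: "M \<in> hypernats \<sigma>"
    "\<And>n. n \<in> hypernats_ge \<sigma> M \<Longrightarrow> x n \<in> sharp_ball \<rho> l (rc_class \<rho> (\<lambda>\<epsilon>. \<rho> \<epsilon> ^ q))"
    using is_hyperlimitE[OF g x lim] by blast
  obtain K where "K \<in> hypernats \<sigma>" "hypernats_ge \<sigma> K \<subseteq> hypernats_ge \<sigma> M \<inter> hypernats_ge \<sigma> N"
    using hypernats_directed[OF s M(1) N(1)] .
  then have "x K \<in> sharp_ball \<rho> l (rc_class \<rho> (\<lambda>\<epsilon>. \<rho> \<epsilon> ^ q))" "x K \<in> C"
    using hypernats_ge_self[OF s] M(2) N(2) by blast+
  then show False
    using q B(3) by blast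
qed

text \<open>Argued directly on representatives at a single common index, rather than through the
  closed set of nonnegative elements and the hyperlimit of the difference.\<close>

lemma hyperlimit_mono:
  assumes g: "gauge_net \<rho>" and s: "gauge_net \<sigma>"
    and x: "x \<in> hypersequences \<sigma> \<rho>" and xl: "is_hyperlimit \<sigma> \<rho> x l"
    and y: "y \<in> hypersequences \<sigma> \<rho>" and yk: "is_hyperlimit \<sigma> \<rho> y k"
    and N: "N \<in> hypernats \<sigma>" "\<And>n. n \<in> hypernats_ge \<sigma> N \<Longrightarrow> rc_le \<rho> (y n) (x n)"
  shows "rc_le \<rho> k l"
proof -
  obtain k' l' where k': "k' \<in> moderate_nets \<rho>" "k = rc_class \<rho> k'"
    and l': "l' \<in> moderate_nets \<rho>" "l = rc_class \<rho> l'"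
    using xl yk by (auto simp: is_hyperlimit_def rc_carrier)
  have "\<forall>\<^sub>F \<epsilon> in at_right 0. k' \<epsilon> \<le> l' \<epsilon> + \<rho> \<epsilon> ^ q" for q
  proof -
    \<comment> \<open>Three errors \<open>\<rho> \<epsilon> ^ (q + 2)\<close> will add up:
      \<open>k\<close> to \<open>y n\<close>, \<open>y n\<close> to \<open>x n\<close>,
      \<open>x n\<close> to \<open>l\<close>. As \<open>\<rho> \<epsilon> < 1 / 2\<close>, their sum
      is at most 3/4 of \<open>\<rho> \<epsilon> ^ q\<close>; the exponent \<open>q + 1\<close>
      would only give the factor 3/2.\<close>
    obtain M1 where M1: "M1 \<in> hypernats \<sigma>" "\<And>n. n \<in> hypernats_ge \<sigma> M1 \<Longrightarrow>
        x n \<in> sharp_ball \<rho> l (rc_class \<rho> (\<lambda>\<epsilon>. \<rho> \<epsilon> ^ (q + 2)))"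
      using is_hyperlimitE[OF g x xl] by blast
    obtain M2 where M2: "M2 \<in> hypernats \<sigma>" "\<And>n. n \<in> hypernats_ge \<sigma> M2 \<Longrightarrow>
        y n \<in> sharp_ball \<rho> k (rc_class \<rho> (\<lambda>\<epsilon>. \<rho> \<epsilon> ^ (q + 2)))"
      using is_hyperlimitE[OF g y yk] by blast
    \<comment> \<open>Directedness is used twice, for the thresholds of the two hyperlimits and then
      for that of the inequality.\<close>
    obtain K where K: "K \<in> hypernats \<sigma>" "hypernats_ge \<sigma> K \<subseteq> hypernats_ge \<sigma> M1 \<inter> hypernats_ge \<sigma> M2"
      using hypernats_directed[OF s M1(1) M2(1)] .
    obtain n where n: "n \<in> hypernats \<sigma>" "hypernats_ge \<sigma> n \<subseteq> hypernats_ge \<sigma> K \<inter> hypernats_ge \<sigma> N"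
      using hypernats_directed[OF s K(1) N(1)] .
    have n_ge: "n \<in> hypernats_ge \<sigma> M1" "n \<in> hypernats_ge \<sigma> M2" "n \<in> hypernats_ge \<sigma> N"
      using hypernats_ge_self[OF s n(1)] n(2) K(2) by blast+
    have "x n \<in> carrier (rc_ring \<rho>)" "y n \<in> carrier (rc_ring \<rho>)"
      using x y n(1) by (auto simp: hypersequences_def)
    then obtain u v where u: "u \<in> moderate_nets \<rho>" "x n = rc_class \<rho> u"
      and v: "v \<in> moderate_nets \<rho>" "y n = rc_class \<rho> v"
      by (auto simp: rc_carrier)
    have "\<forall>\<^sub>F \<epsilon> in at_right 0. \<bar>u \<epsilon> - l' \<epsilon>\<bar> \<le> \<rho> \<epsilon> ^ (q + 2)"
      by (rule sharp_ball_power_dist[OF g l'(1) u(1) M1(2)[OF n_ge(1), unfolded u(2) l'(2)]])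
    moreover have "\<forall>\<^sub>F \<epsilon> in at_right 0. \<bar>v \<epsilon> - k' \<epsilon>\<bar> \<le> \<rho> \<epsilon> ^ (q + 2)"
      by (rule sharp_ball_power_dist[OF g k'(1) v(1) M2(2)[OF n_ge(2), unfolded v(2) k'(2)]])
    moreover have "\<forall>\<^sub>F \<epsilon> in at_right 0. v \<epsilon> \<le> u \<epsilon> + \<rho> \<epsilon> ^ (q + 2)"
      using N(2)[OF n_ge(3)] u v by (simp only: rc_le_iff_power[OF g])
    ultimately show ?thesis
      using gauge_net_eventually[OF g]
    proof eventually_elim
      case (elim \<epsilon>)
      have "\<rho> \<epsilon> ^ 2 \<le> (1 / 2) ^ 2"
        using elim by (intro power_mono) auto
      then have "\<rho> \<epsilon> ^ q * \<rho> \<epsilon> ^ 2 \<le> \<rho> \<epsilon> ^ q * (1 / 4)"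
        using elim by (intro mult_left_mono) (auto simp: power2_eq_square)
      moreover have "0 < \<rho> \<epsilon> ^ q"
        using elim by simp
      ultimately show ?case
        using elim unfolding power_add by linarith
    qed
  qed
  then show ?thesis
    using k' l' by (simp add: rc_le_iff_power[OF g])
qed

theorem theorem39:
  fixes \<rho> \<sigma> :: "real \<Rightarrow> real"
    and x :: "(real \<Rightarrow> real) set \<Rightarrow> (real \<Rightarrow> real) set"
    and l :: "(real \<Rightarrow> real) set"
  assumes "gauge_net \<rho>" and "gauge_net \<sigma>"
    and "x \<in> hypersequences \<sigma> \<rho>"
    and "is_hyperlimit \<sigma> \<rho> x l"
  shows "(\<forall>C. closedin (sharp_topology \<rho>) C \<longrightarrow>
              (\<exists>N\<in>hypernats \<sigma>. \<forall>n\<in>hypernats_ge \<sigma> N. x n \<in> C) \<longrightarrow> l \<in> C) \<and>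
         (\<forall>y k. y \<in> hypersequences \<sigma> \<rho> \<longrightarrow> is_hyperlimit \<sigma> \<rho> y k \<longrightarrow>
              (\<exists>N\<in>hypernats \<sigma>. \<forall>n\<in>hypernats_ge \<sigma> N. rc_le \<rho> (y n) (x n)) \<longrightarrow> rc_le \<rho> k l)"
  using hyperlimit_in_closedin[OF assms] hyperlimit_mono[OF assms] by blast

end
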